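(* Let $\alpha\in[-1,1]$ and let $n\ge 1$ be an integer. For a finite tree $A$, set $H_A(\alpha)=\sum_{u,v\in A}\alpha^{d(u,v)}$. Then the minimum of the map $A\mapsto H_A(\alpha)$ among trees with cardinality $n$ is achieved by the line graph tree with $n$ vertices. Furthermore, when $\alpha\in(-1,0)\cup(0,1)$, the line graph tree of size $n$ is the only tree (up to isomorphism) achieving this minimum.
   Context: Trees are finite unrooted trees; the sum defining $H_A(\alpha)$ (the Hosoya-Wiener polynomial) is over all ordered pairs $(u,v)$ of vertices of $A$, including $u=v$; $d$ is the graph distance in $A$, and $\alpha^0=1$ (including for $\alpha=0$). The cardinality (size) of a tree is its number of vertices. The line graph tree with $n$ vertices is the path on $n$ vertices. *)

theory Defs
  imports Complex_Main "Graph_Theory.Graph_Theory"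
begin

text \<open>
  A finite simple undirected graph is a \<open>pair_graph\<close>: a finite, loop-free, symmetric digraph whose
  arcs are pairs of vertices, each undirected edge being present in both orientations.

  The predicate \<open>tree\<close> of \<open>Graph_Theory\<close> cannot be used for these: there the closed walk
  \<open>u, v, u\<close> along the two orientations of a single edge already counts as a cycle.  An undirected
  cycle has at least three edges, so acyclicity excludes exactly the cycles of length at least 3.
  The empty graph is not connected, hence not a tree.
\<close>

definition undirected_tree :: "'a pair_pre_digraph \<Rightarrow> bool" where
  "undirected_tree T \<longleftrightarrow>
     pair_graph T \<and>
     Digraph_Component.connected (with_proj T) \<and>
     \<not> (\<exists>p. pre_digraph.cycle (with_proj T) p \<and> 3 \<le> length p)"

text \<open>The value is unspecified if \<open>v\<close> is not reachable from \<open>u\<close>; this does not occur in a tree.\<close>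

definition graph_dist :: "'a pair_pre_digraph \<Rightarrow> 'a \<Rightarrow> 'a \<Rightarrow> nat" where
  "graph_dist G u v = (LEAST k. \<exists>p. pre_digraph.awalk (with_proj G) u p v \<and> length p = k)"

definition hosoya_wiener :: "'a pair_pre_digraph \<Rightarrow> real \<Rightarrow> real" where
  "hosoya_wiener A \<alpha> = (\<Sum>u\<in>pverts A. \<Sum>v\<in>pverts A. \<alpha> ^ graph_dist A u v)"

definition line_graph_tree :: "nat \<Rightarrow> nat pair_pre_digraph" where
  "line_graph_tree n =
     \<lparr> pverts = {..<n}, parcs = {(i, j). i < n \<and> j < n \<and> (j = Suc i \<or> i = Suc j)} \<rparr>"

end

theory Submission
  imports Defs
begin

text \<open>
  Let \<open>X\<close> be the random \<open>\<plusminus>1\<close> configuration on a tree in which a fair spin at one vertex is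
  propagated along the edges, each edge having correlation \<open>\<alpha>\<close>; then
  \<open>\<alpha> ^ d(u,v)\<close> is the expectation of \<open>X\<^sub>u X\<^sub>v\<close>.  Up to terms depending only on \<open>\<alpha>\<close> and the number
  \<open>n\<close> of vertices, \<open>(1 - \<alpha>)\<^sup>2 H\<close> equals \<open>\<alpha>\<^sup>2 Q\<close>, where \<open>Q\<close> is the second moment of
  \<open>S = \<Sum>\<^sub>v (2 - deg v) X\<^sub>v\<close>.  Since the charges \<open>2 - deg v\<close> sum to 2, \<open>S\<close> is an even integer, and
  \<open>S / 2\<close> is odd exactly when \<open>P = \<Prod>\<^sub>v X\<^sub>v ^ deg v\<close> is 1.  Hence \<open>S\<^sup>2 \<ge> 2 (1 + P)\<close>.  As \<open>P\<close> is also
  the product of \<open>X\<^sub>u X\<^sub>v\<close> over the edges, its expectation is \<open>\<alpha> ^ (n - 1)\<close>, so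
  \<open>Q \<ge> 2 (1 + \<alpha> ^ (n - 1))\<close>.  The pointwise bound is an equality for all configurations if and only
  if all degrees are at most 2, and for \<open>\<bar>\<alpha>\<bar> < 1\<close> every configuration has positive probability.
\<close>

section \<open>Trees grown leaf by leaf, and their distances\<close>

text \<open>Recursive presentation with both orientations of each edge, so that every quantity can
  be followed through the attachment of one leaf. By \<open>undirected_tree_leaf_tree\<close> all
  undirected trees arise this way.\<close>

inductive leaf_tree :: "'a set \<Rightarrow> 'a rel \<Rightarrow> bool" where
  single: "leaf_tree {r} {}"
| leaf: "leaf_tree V E \<Longrightarrow> u \<in> V \<Longrightarrow> v \<notin> V \<Longrightarrow>
    leaf_tree (insert v V) (insert (u, v) (insert (v, u) E))"

abbreviation deg :: "'a rel \<Rightarrow> 'a \<Rightarrow> nat" where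
  "deg E x \<equiv> card (E `` {x})"

definition rdist :: "'a rel \<Rightarrow> 'a \<Rightarrow> 'a \<Rightarrow> nat" where
  "rdist E x y = (LEAST k. (x, y) \<in> E ^^ k)"

lemma leaf_tree_finite: "leaf_tree V E \<Longrightarrow> finite V"
  by (induction rule: leaf_tree.induct) auto

lemma leaf_tree_nonempty: "leaf_tree V E \<Longrightarrow> V \<noteq> {}"
  by (induction rule: leaf_tree.induct) auto

lemma leaf_tree_subset: "leaf_tree V E \<Longrightarrow> E \<subseteq> V \<times> V"
  by (induction rule: leaf_tree.induct) auto

lemma leaf_tree_sym: "leaf_tree V E \<Longrightarrow> sym E"
  by (induction rule: leaf_tree.induct) (auto simp: sym_def)

lemma leaf_tree_finite_edges: "leaf_tree V E \<Longrightarrow> finite (E `` {x})"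
  using leaf_tree_finite leaf_tree_subset
  by (metis finite_Image finite_SigmaI finite_subset)

lemma pcas_snoc:
  "pcas x p u \<Longrightarrow> pcas x (p @ [(u, v)]) v \<and> pawalk_verts x (p @ [(u, v)]) = pawalk_verts x p @ [v]"
  by (induction p arbitrary: x) auto

text \<open>The path is extended at whichever end is the new leaf \<open>v\<close>; since
  \<open>v\<close> is fresh, no vertex repeats. Distinctness later turns such a path into a cycle
  when it is closed up through an outside vertex.\<close>

lemma leaf_tree_path:
  assumes "leaf_tree V E" "x \<in> V" "y \<in> V"
  shows "\<exists>p. pcas x p y \<and> set p \<subseteq> E \<and> distinct (pawalk_verts x p) \<and> set (pawalk_verts x p) \<subseteq> V"
  using assms
proof (induction arbitrary: x y rule: leaf_tree.induct)
  case (single r)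
  then show ?case by (intro exI[of _ "[]"]) auto
next
  case (leaf V E u v)
  have mono: "set p \<subseteq> E \<Longrightarrow> set p \<subseteq> insert (u, v) (insert (v, u) E)" for p :: "('a \<times> 'a) list"
    by blast
  consider "x \<in> V" "y \<in> V" | "x = v" "y = v" | "x = v" "y \<in> V" | "x \<in> V" "y = v"
    using leaf.prems by blast
  then show ?case
  proof cases
    case 1
    then show ?thesis using leaf.IH[of x y] mono by (metis subset_insertI2)
  next
    case 2
    then show ?thesis by (intro exI[of _ "[]"]) auto
  next
    case 3
    obtain p where "pcas u p y" "set p \<subseteq> E" "distinct (pawalk_verts u p)" "set (pawalk_verts u p) \<subseteq> V"
      using leaf.IH[OF leaf.hyps(2) 3(2)] by blast
    then show ?thesis
      using 3 leaf.hyps by (intro exI[of _ "(v, u) # p"]) auto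
  next
    case 4
    obtain p where "pcas x p u" "set p \<subseteq> E" "distinct (pawalk_verts x p)" "set (pawalk_verts x p) \<subseteq> V"
      using leaf.IH[OF 4(1) leaf.hyps(2)] by blast
    then show ?thesis
      using 4 leaf.hyps pcas_snoc[of x p] by (intro exI[of _ "p @ [(u, v)]"]) auto
  qed
qed

lemma pcas_relpow: "pcas x p y \<Longrightarrow> set p \<subseteq> E \<Longrightarrow> (x, y) \<in> E ^^ length p"
  by (induction p arbitrary: x) (auto simp del: relpow.simps(2) intro: relpow_Suc_I2)

lemma relpow_pcas: "(x, y) \<in> E ^^ k \<Longrightarrow> \<exists>p. pcas x p y \<and> set p \<subseteq> E \<and> length p = k"
proof (induction k arbitrary: x)
  case 0
  then show ?case by (intro exI[of _ "[]"]) auto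
next
  case (Suc k)
  then obtain z where z: "(x, z) \<in> E" "(z, y) \<in> E ^^ k" by (meson relpow_Suc_D2)
  then obtain p where "pcas z p y \<and> set p \<subseteq> E \<and> length p = k" using Suc.IH by blast
  then show ?case using z by (intro exI[of _ "(x, z) # p"]) auto
qed

text \<open>Relation powers replace arc lists. An \<open>awalk\<close> must start at a vertex of the
  graph, whence the assumption on \<open>x\<close>.\<close>

lemma graph_dist_eq_rdist:
  assumes "x \<in> pverts G"
  shows "graph_dist G x y = rdist (parcs G) x y"
proof -
  have "(\<exists>p. pre_digraph.awalk (with_proj G) x p y \<and> length p = k) \<longleftrightarrow> (x, y) \<in> parcs G ^^ k" for k
    using assms pcas_relpow[of x _ y "parcs G"] relpow_pcas[of x y k "parcs G"]
    by (auto simp: pre_digraph.awalk_def cas_with_proj_eq)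
  then show ?thesis by (simp add: graph_dist_def rdist_def)
qed

lemma leaf_tree_connected:
  assumes "leaf_tree V E" "x \<in> V" "y \<in> V"
  shows "(x, y) \<in> E ^^ rdist E x y"
proof -
  obtain p where "pcas x p y" "set p \<subseteq> E" using leaf_tree_path[OF assms] by blast
  then have "(x, y) \<in> E ^^ length p" by (rule pcas_relpow)
  then show ?thesis unfolding rdist_def by (rule LeastI)
qed

lemma rdist_self [simp]: "rdist E x x = 0"
  by (simp add: rdist_def)

lemma relpow_sym: "sym E \<Longrightarrow> (x, y) \<in> E ^^ k \<Longrightarrow> (y, x) \<in> E ^^ k"
proof (induction k arbitrary: y)
  case (Suc k)
  then obtain z where "(x, z) \<in> E ^^ k" "(z, y) \<in> E" by auto
  then show ?case using Suc by (meson relpow_Suc_I2 symD)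
qed auto

lemma rdist_sym: "sym E \<Longrightarrow> rdist E x y = rdist E y x"
  unfolding rdist_def by (metis relpow_sym)

context
  fixes V :: "'a set" and E E' :: "'a rel" and u v :: 'a
  assumes tree: "leaf_tree V E" and u: "u \<in> V" and v: "v \<notin> V"
    and E': "E' = insert (u, v) (insert (v, u) E)"
begin

lemma relpow_leaf_mono: "(x, y) \<in> E ^^ k \<Longrightarrow> (x, y) \<in> E' ^^ k"
  by (induction k arbitrary: y) (auto simp: E')

text \<open>Retracting the new leaf onto its neighbour does not lengthen walks.\<close>

lemma relpow_retract:
  assumes "(x, y) \<in> E' ^^ k" "x \<noteq> v"
  shows "\<exists>j\<le>k. (x, if y = v then u else y) \<in> E ^^ j \<and> (y = v \<longrightarrow> j < k)"
  using assms(1)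
proof (induction k arbitrary: y)
  case 0
  then show ?case using assms(2) by auto
next
  case (Suc k)
  then obtain z where z: "(x, z) \<in> E' ^^ k" "(z, y) \<in> E'" by auto
  obtain j where j: "j \<le> k" "(x, if z = v then u else z) \<in> E ^^ j" "z = v \<longrightarrow> j < k"
    using Suc.IH[OF z(1)] by blast
  have E: "E \<subseteq> V \<times> V" using tree by (rule leaf_tree_subset)
  have "(z = u \<and> y = v) \<or> (z = v \<and> y = u) \<or> ((z, y) \<in> E \<and> z \<noteq> v \<and> y \<noteq> v)"
    using z(2) E v by (auto simp: E')
  then show ?case
  proof (elim disjE conjE)
    \<comment> \<open>The step onto the leaf is collapsed: \<open>j\<close> stays while the bound
      rises to \<open>Suc k\<close>. This is the source of the strictness for
      \<open>y = v\<close>.\<close>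
    assume "z = u" "y = v"
    then show ?thesis using j u v by (intro exI[of _ j]) auto
  next
    assume "z = v" "y = u"
    then show ?thesis using j u v by (intro exI[of _ j]) auto
  next
    assume "(z, y) \<in> E" "z \<noteq> v" "y \<noteq> v"
    then show ?thesis using j by (intro exI[of _ "Suc j"]) auto
  qed
qed

lemma rdist_leaf_old:
  assumes "x \<in> V" "y \<in> V"
  shows "rdist E' x y = rdist E x y"
proof (rule antisym)
  have tree': "leaf_tree (insert v V) E'" unfolding E' by (intro leaf_tree.leaf tree u v)
  show "rdist E' x y \<le> rdist E x y"
    unfolding rdist_def[of E']
    by (intro Least_le relpow_leaf_mono leaf_tree_connected[OF tree assms])
  have "x \<noteq> v" "y \<noteq> v" using assms v by auto
  then obtain j where "j \<le> rdist E' x y" "(x, y) \<in> E ^^ j"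
    using relpow_retract[OF leaf_tree_connected[OF tree', of x y]] assms by auto
  then show "rdist E x y \<le> rdist E' x y"
    unfolding rdist_def[of E] by (meson Least_le order_trans)
qed

lemma rdist_leaf_new:
  assumes "x \<in> V"
  shows "rdist E' x v = Suc (rdist E x u)" and "rdist E' v x = Suc (rdist E u x)"
proof -
  have tree': "leaf_tree (insert v V) E'" unfolding E' by (intro leaf_tree.leaf tree u v)
  show *: "rdist E' x v = Suc (rdist E x u)"
  proof (rule antisym)
    have "(x, u) \<in> E' ^^ rdist E x u"
      by (intro relpow_leaf_mono leaf_tree_connected[OF tree assms u])
    then have "(x, v) \<in> E' ^^ Suc (rdist E x u)" by (auto simp: E')
    then show "rdist E' x v \<le> Suc (rdist E x u)" unfolding rdist_def[of E'] by (rule Least_le)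
    \<comment> \<open>The strict case of the retraction accounts for the extra arc from
      \<open>u\<close> to \<open>v\<close>.\<close>
    obtain j where "j < rdist E' x v" "(x, u) \<in> E ^^ j"
      using relpow_retract[OF leaf_tree_connected[OF tree', of x v]] assms v by auto
    then show "Suc (rdist E x u) \<le> rdist E' x v"
      unfolding rdist_def[of E] by (meson Least_le Suc_leI order_le_less_trans)
  qed
  show "rdist E' v x = Suc (rdist E u x)"
    using * rdist_sym[OF leaf_tree_sym[OF tree]] rdist_sym[OF leaf_tree_sym[OF tree']] by metis
qed

lemma deg_leaf:
  "deg E' v = 1" "deg E' u = Suc (deg E u)" "x \<in> V \<Longrightarrow> x \<noteq> u \<Longrightarrow> deg E' x = deg E x"
proof -
  have E: "E \<subseteq> V \<times> V" using tree by (rule leaf_tree_subset)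
  have "E' `` {v} = {u}" using E u v by (auto simp: E')
  then show "deg E' v = 1" by simp
  have "E' `` {u} = insert v (E `` {u})" "v \<notin> E `` {u}" using E u v by (auto simp: E')
  then show "deg E' u = Suc (deg E u)" using leaf_tree_finite_edges[OF tree] by simp
  assume "x \<in> V" "x \<noteq> u"
  then have "E' `` {x} = E `` {x}" using v by (auto simp: E')
  then show "deg E' x = deg E x" by simp
qed

text \<open>The leaf has degree 1, hence charge 1; the degree of \<open>u\<close> rises by one, so
  its charge drops by one.\<close>

lemma sum_charge_leaf:
  fixes g :: "'a \<Rightarrow> real"
  shows "(\<Sum>y\<in>insert v V. (2 - real (deg E' y)) * g y) =
    (\<Sum>y\<in>V. (2 - real (deg E y)) * g y) - g u + g v"
proof -
  have fin: "finite V" using tree by (rule leaf_tree_finite)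
  have "(\<Sum>y\<in>V. (2 - real (deg E' y)) * g y)
      = (\<Sum>y\<in>V. (2 - real (deg E y)) * g y - (if y = u then g y else 0))"
    by (intro sum.cong) (auto simp: deg_leaf algebra_simps)
  also have "\<dots> = (\<Sum>y\<in>V. (2 - real (deg E y)) * g y) - g u"
    using u fin by (simp add: sum_subtractf)
  finally show ?thesis using fin v by (simp add: deg_leaf(1))
qed

end

section \<open>Charges and the energy identity\<close>

lemma leaf_tree_sum_charge: "leaf_tree V E \<Longrightarrow> (\<Sum>y\<in>V. 2 - real (deg E y)) = 2"
proof (induction rule: leaf_tree.induct)
  case (leaf V E u v)
  then show ?case using sum_charge_leaf[OF leaf.hyps refl, of "\<lambda>_. 1"] by simp
qed simp

text \<open>
  The charges \<open>2 - deg y\<close> come from inverting the matrix of all \<open>\<alpha> ^ d(x,y)\<close>, which maps the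
  all-ones vector to \<open>(1 + \<alpha> (1 - deg y)) / (1 + \<alpha>)\<close>.
\<close>

lemma leaf_tree_potential:
  fixes \<alpha> :: real
  assumes "leaf_tree V E" "x \<in> V"
  shows "\<alpha> * (\<Sum>y\<in>V. (2 - real (deg E y)) * \<alpha> ^ rdist E x y)
    = 1 + \<alpha> - (1 - \<alpha>) * (\<Sum>y\<in>V. \<alpha> ^ rdist E x y)"
  using assms
proof (induction arbitrary: x rule: leaf_tree.induct)
  case (single r)
  then show ?case by simp
next
  case (leaf V E u v)
  define E' where "E' = insert (u, v) (insert (v, u) E)"
  note old = rdist_leaf_old[OF leaf.hyps E'_def]
  note new = rdist_leaf_new[OF leaf.hyps E'_def]
  note charge = sum_charge_leaf[OF leaf.hyps E'_def]
  have fin: "finite V" using leaf.hyps(1) by (rule leaf_tree_finite)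
  define q where "q x = (\<Sum>y\<in>V. (2 - real (deg E y)) * \<alpha> ^ rdist E x y)" for x
  define f where "f x = (\<Sum>y\<in>V. \<alpha> ^ rdist E x y)" for x
  have IH: "\<alpha> * q x = 1 + \<alpha> - (1 - \<alpha>) * f x" if "x \<in> V" for x
    using leaf.IH[OF that] by (simp add: q_def f_def)
  show ?case
  proof (cases "x = v")
    case True
    \<comment> \<open>Distances from \<open>v\<close> into \<open>V\<close> exceed those from
      \<open>u\<close> by one, so both sums over \<open>V\<close> pick up a factor \<alpha>.\<close>
    have "(\<Sum>y\<in>V. \<alpha> ^ rdist E' v y) = \<alpha> * f u"
      by (simp add: f_def sum_distrib_left new cong: sum.cong)
    then have f: "(\<Sum>y\<in>insert v V. \<alpha> ^ rdist E' v y) = 1 + \<alpha> * f u"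
      using fin leaf.hyps by simp
    have "(\<Sum>y\<in>V. (2 - real (deg E y)) * \<alpha> ^ rdist E' v y) = \<alpha> * q u"
      by (simp add: q_def sum_distrib_left new mult_ac cong: sum.cong)
    then have q: "(\<Sum>y\<in>insert v V. (2 - real (deg E' y)) * \<alpha> ^ rdist E' v y) = \<alpha> * q u - \<alpha> + 1"
      using leaf.hyps by (simp add: charge new)
    show ?thesis
      unfolding E'_def[symmetric] True f q using IH[OF leaf.hyps(2)] by algebra
  next
    case False
    then have x: "x \<in> V" using leaf.prems by simp
    have "(\<Sum>y\<in>V. \<alpha> ^ rdist E' x y) = f x"
      using x by (simp add: f_def old cong: sum.cong)
    then have f: "(\<Sum>y\<in>insert v V. \<alpha> ^ rdist E' x y) = f x + \<alpha> * \<alpha> ^ rdist E x u"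
      using fin leaf.hyps x by (simp add: new)
    have "(\<Sum>y\<in>V. (2 - real (deg E y)) * \<alpha> ^ rdist E' x y) = q x"
      using x by (simp add: q_def old cong: sum.cong)
    then have q: "(\<Sum>y\<in>insert v V. (2 - real (deg E' y)) * \<alpha> ^ rdist E' x y)
        = q x - \<alpha> ^ rdist E x u + \<alpha> * \<alpha> ^ rdist E x u"
      using leaf.hyps x by (simp add: charge new old)
    \<comment> \<open>With t = \<open>\<alpha> ^ rdist E x u\<close>, both sides change by \<alpha>
      (\<alpha> - 1) t.\<close>
    show ?thesis
      unfolding E'_def[symmetric] f q using IH[OF x] by (simp add: algebra_simps)
  qed
qed

text \<open>Summing the potential identity once with the charges as weights and once uniformly gives
  two linear equations; eliminating the sum of all \<open>q x\<close> between them leaves the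
  claim.\<close>

lemma leaf_tree_energy:
  fixes \<alpha> :: real
  assumes "leaf_tree V E"
  shows "(1 - \<alpha>)\<^sup>2 * (\<Sum>x\<in>V. \<Sum>y\<in>V. \<alpha> ^ rdist E x y)
    = real (card V) * (1 - \<alpha>\<^sup>2) - 2 * \<alpha> * (1 + \<alpha>)
      + \<alpha>\<^sup>2 * (\<Sum>x\<in>V. \<Sum>y\<in>V. (2 - real (deg E x)) * (2 - real (deg E y)) * \<alpha> ^ rdist E x y)"
proof -
  define c where "c x = 2 - real (deg E x)" for x
  define q where "q x = (\<Sum>y\<in>V. c y * \<alpha> ^ rdist E x y)" for x
  define f where "f x = (\<Sum>y\<in>V. \<alpha> ^ rdist E x y)" for x
  define F where "F = (\<Sum>x\<in>V. f x)"
  define Q where "Q = (\<Sum>x\<in>V. c x * q x)"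
  have local: "\<alpha> * q x = 1 + \<alpha> - (1 - \<alpha>) * f x" if "x \<in> V" for x
    using leaf_tree_potential[OF assms that] by (simp add: q_def f_def c_def)
  have "\<alpha> * Q = (\<Sum>x\<in>V. c x * (\<alpha> * q x))"
    by (simp add: Q_def sum_distrib_left mult_ac)
  also have "\<dots> = (\<Sum>x\<in>V. (1 + \<alpha>) * c x - (1 - \<alpha>) * (c x * f x))"
    by (intro sum.cong) (auto simp: local algebra_simps)
  also have "\<dots> = (1 + \<alpha>) * (\<Sum>x\<in>V. c x) - (1 - \<alpha>) * (\<Sum>x\<in>V. c x * f x)"
    by (simp add: sum_subtractf sum_distrib_left)
  also have "(\<Sum>x\<in>V. c x) = 2"
    using leaf_tree_sum_charge[OF assms] by (simp add: c_def)
  \<comment> \<open>Symmetry of the distance moves the charge from one endpoint to the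
    other.\<close>
  also have "(\<Sum>x\<in>V. c x * f x) = (\<Sum>x\<in>V. q x)"
    unfolding f_def q_def sum_distrib_left
    by (subst sum.swap) (simp add: rdist_sym[OF leaf_tree_sym[OF assms]])
  finally have 1: "\<alpha> * Q = (1 + \<alpha>) * 2 - (1 - \<alpha>) * (\<Sum>x\<in>V. q x)" .
  have "\<alpha> * (\<Sum>x\<in>V. q x) = (\<Sum>x\<in>V. 1 + \<alpha> - (1 - \<alpha>) * f x)"
    by (simp add: sum_distrib_left local)
  also have "\<dots> = real (card V) * (1 + \<alpha>) - (1 - \<alpha>) * F"
    by (simp add: sum_subtractf sum_distrib_left F_def)
  finally have 2: "\<alpha> * (\<Sum>x\<in>V. q x) = real (card V) * (1 + \<alpha>) - (1 - \<alpha>) * F" .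
  have "(1 - \<alpha>)\<^sup>2 * F = real (card V) * (1 - \<alpha>\<^sup>2) - 2 * \<alpha> * (1 + \<alpha>) + \<alpha>\<^sup>2 * Q"
    using 1 2 by algebra
  then show ?thesis
    by (simp add: F_def f_def Q_def q_def c_def sum_distrib_left mult_ac)
qed

section \<open>Random spin configurations on a tree\<close>

text \<open>A configuration is coded by the set \<open>Y\<close> of vertices with spin -1, so
  expectations are finite sums over \<open>Pow V\<close>.\<close>

definition spin :: "'a set \<Rightarrow> 'a \<Rightarrow> real" where
  "spin Y x = (if x \<in> Y then -1 else 1)"

lemma spin_mult_self [simp]: "spin Y x * spin Y x = 1"
  by (simp add: spin_def)

lemma sum_Pow_insert:
  fixes g :: "'a set \<Rightarrow> real"
  assumes "finite V" "v \<notin> V"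
  shows "(\<Sum>Y\<in>Pow (insert v V). g Y) = (\<Sum>Y\<in>Pow V. g Y + g (insert v Y))"
proof -
  have "inj_on (insert v) (Pow V)" using assms(2) by (auto simp: inj_on_def)
  moreover have "Pow V \<inter> insert v ` Pow V = {}" using assms(2) by auto
  ultimately show ?thesis
    using assms by (simp add: Pow_insert sum.union_disjoint sum.reindex sum.distrib)
qed

text \<open>\<open>w\<close> is the law of the propagated spins: the spin of a new leaf agrees with
  that of its neighbour with probability (1 + \<alpha>) / 2. Total mass 1 is the correlation clause
  at \<open>x = y\<close>.\<close>

lemma leaf_tree_spin_weights:
  fixes \<alpha> :: real
  assumes "leaf_tree V E" and "\<bar>\<alpha>\<bar> \<le> 1"
  shows "\<exists>w. (\<forall>Y\<in>Pow V. 0 \<le> w Y \<and> (\<bar>\<alpha>\<bar> < 1 \<longrightarrow> 0 < w Y)) \<and>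
    (\<forall>x\<in>V. \<forall>y\<in>V. (\<Sum>Y\<in>Pow V. w Y * (spin Y x * spin Y y)) = \<alpha> ^ rdist E x y) \<and>
    (\<Sum>Y\<in>Pow V. w Y * (\<Prod>x\<in>V. spin Y x ^ deg E x)) = \<alpha> ^ (card V - 1)"
  using assms(1)
proof (induction rule: leaf_tree.induct)
  case (single r)
  have "Pow {r} = {{}, {r}}" by auto
  then show ?case by (intro exI[of _ "\<lambda>_. 1 / 2"]) simp
next
  case (leaf V E u v)
  define E' where "E' = insert (u, v) (insert (v, u) E)"
  note old = rdist_leaf_old[OF leaf.hyps E'_def]
  note new = rdist_leaf_new[OF leaf.hyps E'_def]
  note deg = deg_leaf[OF leaf.hyps E'_def]
  note u = leaf.hyps(2) and v = leaf.hyps(3)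
  have fin: "finite V" using leaf.hyps(1) by (rule leaf_tree_finite)
  obtain w where w: "\<forall>Y\<in>Pow V. 0 \<le> w Y \<and> (\<bar>\<alpha>\<bar> < 1 \<longrightarrow> 0 < w Y)"
    and corr: "\<And>x y. x \<in> V \<Longrightarrow> y \<in> V \<Longrightarrow> (\<Sum>Y\<in>Pow V. w Y * (spin Y x * spin Y y)) = \<alpha> ^ rdist E x y"
    and parity: "(\<Sum>Y\<in>Pow V. w Y * (\<Prod>x\<in>V. spin Y x ^ deg E x)) = \<alpha> ^ (card V - 1)"
    using leaf.IH by blast
  \<comment> \<open>The second factor is the conditional probability of the spin at \<open>v\<close>
    given the spin at \<open>u\<close>.\<close>
  define w' where "w' Y = w (Y - {v}) * ((1 + \<alpha> * (spin Y u * spin Y v)) / 2)" for Y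
  have spin_old: "spin (insert v Y) x = spin Y x" if "x \<in> V" for x Y
    using that v by (auto simp: spin_def)
  have spin_v: "spin (insert v Y) v = -1" "Y \<subseteq> V \<Longrightarrow> spin Y v = 1" for Y
    using v by (auto simp: spin_def)
  have split: "(\<Sum>Y\<in>Pow (insert v V). w' Y * g Y) =
      (\<Sum>Y\<in>Pow V. w Y * ((1 + \<alpha> * spin Y u) / 2 * g Y + (1 - \<alpha> * spin Y u) / 2 * g (insert v Y)))"
    for g
  proof -
    have "Y - {v} = Y" "insert v Y - {v} = Y" if "Y \<subseteq> V" for Y using that v by auto
    then show ?thesis
      unfolding sum_Pow_insert[OF fin v]
      by (intro sum.cong) (auto simp: w'_def spin_old[OF u] spin_v distrib_left mult.assoc)
  qed
  show ?case
    unfolding E'_def[symmetric]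
  proof (intro exI[of _ w'] conjI ballI)
    fix Y assume "Y \<in> Pow (insert v V)"
    then have Y: "Y - {v} \<in> Pow V" by auto
    have "\<bar>\<alpha> * (spin Y u * spin Y v)\<bar> = \<bar>\<alpha>\<bar>" by (simp add: spin_def)
    then have "0 \<le> 1 + \<alpha> * (spin Y u * spin Y v)"
      and "\<bar>\<alpha>\<bar> < 1 \<longrightarrow> 0 < 1 + \<alpha> * (spin Y u * spin Y v)"
      using assms(2) by linarith+
    then show "0 \<le> w' Y" "\<bar>\<alpha>\<bar> < 1 \<longrightarrow> 0 < w' Y"
      using w Y by (auto simp: w'_def)
  next
    have vv: "(\<Sum>Y\<in>Pow V. w Y) = 1" using corr[OF u u] by simp
    have xv: "(\<Sum>Y\<in>Pow (insert v V). w' Y * (spin Y x * spin Y v)) = \<alpha> * \<alpha> ^ rdist E x u"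
      if "x \<in> V" for x
    proof -
      have "(\<Sum>Y\<in>Pow (insert v V). w' Y * (spin Y x * spin Y v))
          = (\<Sum>Y\<in>Pow V. \<alpha> * (w Y * (spin Y x * spin Y u)))"
        unfolding split by (intro sum.cong) (auto simp: spin_old[OF that] spin_v field_simps)
      then show ?thesis using corr[OF that u] by (simp add: sum_distrib_left[symmetric])
    qed
    fix x y assume xy: "x \<in> insert v V" "y \<in> insert v V"
    consider "x \<in> V" "y \<in> V" | "x = v" "y = v" | "x = v" "y \<in> V" | "x \<in> V" "y = v"
      using xy by blast
    then show "(\<Sum>Y\<in>Pow (insert v V). w' Y * (spin Y x * spin Y y)) = \<alpha> ^ rdist E' x y"
    proof cases
      case 1
      have "(\<Sum>Y\<in>Pow (insert v V). w' Y * (spin Y x * spin Y y))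
          = (\<Sum>Y\<in>Pow V. w Y * (spin Y x * spin Y y))"
        unfolding split by (intro sum.cong) (auto simp: spin_old 1 field_simps)
      then show ?thesis using corr[OF 1] old[OF 1] by simp
    next
      case 2
      have "(\<Sum>Y\<in>Pow (insert v V). w' Y * (spin Y v * spin Y v)) = (\<Sum>Y\<in>Pow V. w Y)"
        unfolding split by (intro sum.cong) (auto simp: field_simps)
      then show ?thesis using 2 vv by simp
    next
      case 3
      then show ?thesis
        using xv[of y] new[of y] rdist_sym[OF leaf_tree_sym[OF leaf.hyps(1)], of u y]
        by (simp add: mult.commute[of "spin _ v"])
    next
      case 4
      then show ?thesis using xv[of x] new[of x] by simp
    qed
  next
    \<comment> \<open>The degree of \<open>u\<close> grows by one whatever the sign of
      \<open>v\<close>, which contributes one more \<open>spin Y u\<close>.\<close>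
    have prod: "(\<Prod>x\<in>V. spin Z x ^ deg E' x) = (\<Prod>x\<in>V. spin Y x ^ deg E x) * spin Y u"
      if "Z = Y \<or> Z = insert v Y" for Y Z
    proof -
      have "(\<Prod>x\<in>V. spin Z x ^ deg E' x) = (\<Prod>x\<in>V. spin Y x ^ deg E x * (if x = u then spin Y x else 1))"
        using that by (intro prod.cong) (auto simp: deg spin_old)
      then show ?thesis using u fin by (simp add: prod.distrib)
    qed
    have "(\<Sum>Y\<in>Pow (insert v V). w' Y * (\<Prod>x\<in>insert v V. spin Y x ^ deg E' x))
        = (\<Sum>Y\<in>Pow V. \<alpha> * (w Y * (\<Prod>x\<in>V. spin Y x ^ deg E x)))"
      unfolding split
    proof (intro sum.cong refl)
      fix Y assume "Y \<in> Pow V"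
      then have Y: "Y \<subseteq> V" by simp
      show "w Y * ((1 + \<alpha> * spin Y u) / 2 * (\<Prod>x\<in>insert v V. spin Y x ^ deg E' x)
          + (1 - \<alpha> * spin Y u) / 2 * (\<Prod>x\<in>insert v V. spin (insert v Y) x ^ deg E' x))
        = \<alpha> * (w Y * (\<Prod>x\<in>V. spin Y x ^ deg E x))"
      proof -
        have "(\<Prod>x\<in>insert v V. spin Y x ^ deg E' x) = (\<Prod>x\<in>V. spin Y x ^ deg E x) * spin Y u"
          and "(\<Prod>x\<in>insert v V. spin (insert v Y) x ^ deg E' x)
            = - ((\<Prod>x\<in>V. spin Y x ^ deg E x) * spin Y u)"
          using prod[of Y Y] prod[of "insert v Y" Y] fin v spin_v(1) spin_v(2)[OF Y] deg(1) by simp_all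
        \<comment> \<open>Averaging over the sign of \<open>v\<close> replaces its spin by \<alpha>
          times \<open>spin Y u\<close>, and the two factors \<open>spin Y u\<close> cancel.\<close>
        then show ?thesis
          using spin_mult_self[of Y u] by algebra
      qed
    qed
    also have "\<dots> = \<alpha> * \<alpha> ^ (card V - 1)" using parity by (simp add: sum_distrib_left[symmetric])
    \<comment> \<open>\<open>V\<close> contains \<open>u\<close>, so \<open>card V - 1\<close> is
      not truncated.\<close>
    also have "\<dots> = \<alpha> ^ (card (insert v V) - 1)"
      using fin v u by (cases "card V") auto
    finally show "(\<Sum>Y\<in>Pow (insert v V). w' Y * (\<Prod>x\<in>insert v V. spin Y x ^ deg E' x))
        = \<alpha> ^ (card (insert v V) - 1)" .
  qed
qed

section \<open>Parity of the charged spin sum\<close>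

text \<open>Flipping the spins in \<open>Y\<close> subtracts twice the charge of \<open>Y\<close>
  from the total 2. With m the degree sum over \<open>Y\<close>, this gives k = 1 - 2 |Y| + m, while
  the product is (-1)^m; k and m have opposite parity.\<close>

lemma spin_sum_parity:
  assumes "finite V" "Y \<subseteq> V" "(\<Sum>x\<in>V. 2 - real (d x)) = 2"
  obtains k :: int where "(\<Sum>x\<in>V. (2 - real (d x)) * spin Y x) = 2 * of_int k"
    and "(\<Prod>x\<in>V. spin Y x ^ d x) = (if even k then -1 else 1)"
proof
  define m where "m = (\<Sum>x\<in>Y. d x)"
  have fin: "finite Y" using assms finite_subset by blast
  have "(\<Sum>x\<in>V. (2 - real (d x)) * spin Y x)
      = (\<Sum>x\<in>V. (2 - real (d x)) - (if x \<in> Y then 2 * (2 - real (d x)) else 0))"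
    by (intro sum.cong) (auto simp: spin_def)
  also have "\<dots> = 2 - (\<Sum>x\<in>Y. 2 * (2 - real (d x)))"
    using assms by (simp add: sum_subtractf sum.inter_restrict[symmetric] Int_absorb1)
  also have "\<dots> = 2 * of_int (1 - 2 * int (card Y) + int m)"
    by (simp add: m_def sum_subtractf sum_distrib_left algebra_simps)
  finally show "(\<Sum>x\<in>V. (2 - real (d x)) * spin Y x) = 2 * of_int (1 - 2 * int (card Y) + int m)" .
  have "(\<Prod>x\<in>V. spin Y x ^ d x) = (\<Prod>x\<in>V. if x \<in> Y then (-1) ^ d x else 1)"
    by (intro prod.cong) (auto simp: spin_def)
  also have "\<dots> = (-1) ^ m"
    using assms by (simp add: m_def power_sum prod.inter_restrict[symmetric] Int_absorb1)
  finally show "(\<Prod>x\<in>V. spin Y x ^ d x) = (if even (1 - 2 * int (card Y) + int m) then -1 else 1)"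
    by simp
qed

text \<open>For even \<open>k\<close> the left side is 0; for odd \<open>k\<close> it is 4, and an
  odd integer has square at least 1.\<close>

lemma spin_sum_square_ge:
  assumes "finite V" "Y \<subseteq> V" "(\<Sum>x\<in>V. 2 - real (d x)) = 2"
  shows "2 * (1 + (\<Prod>x\<in>V. spin Y x ^ d x)) \<le> (\<Sum>x\<in>V. (2 - real (d x)) * spin Y x)\<^sup>2"
proof -
  obtain k :: int where S: "(\<Sum>x\<in>V. (2 - real (d x)) * spin Y x) = 2 * of_int k"
    and P: "(\<Prod>x\<in>V. spin Y x ^ d x) = (if even k then -1 else 1)"
    using spin_sum_parity[OF assms] .
  show ?thesis
  proof (cases "even k")
    case False
    then have "k\<^sup>2 \<noteq> 0" by auto
    then have "1 \<le> k\<^sup>2" using zero_le_power2[of k] by linarith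
    then have "(1::real) \<le> (of_int k)\<^sup>2" by (metis of_int_1_le_iff of_int_power)
    then show ?thesis unfolding S P using False by (simp add: power_mult_distrib)
  qed (auto simp: P)
qed

text \<open>Without negative charges the sum is at most the total charge 2 in absolute value, so
  \<open>k\<close> is -1, 0 or 1, and each of these attains the bound.\<close>

lemma spin_sum_square_eq:
  assumes "finite V" "Y \<subseteq> V" "(\<Sum>x\<in>V. 2 - real (d x)) = 2" and deg: "\<And>x. x \<in> V \<Longrightarrow> d x \<le> 2"
  shows "(\<Sum>x\<in>V. (2 - real (d x)) * spin Y x)\<^sup>2 = 2 * (1 + (\<Prod>x\<in>V. spin Y x ^ d x))"
proof -
  obtain k :: int where S: "(\<Sum>x\<in>V. (2 - real (d x)) * spin Y x) = 2 * of_int k"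
    and P: "(\<Prod>x\<in>V. spin Y x ^ d x) = (if even k then -1 else 1)"
    using spin_sum_parity[OF assms(1-3)] .
  have "\<bar>\<Sum>x\<in>V. (2 - real (d x)) * spin Y x\<bar> \<le> (\<Sum>x\<in>V. \<bar>(2 - real (d x)) * spin Y x\<bar>)"
    by (rule sum_abs)
  also have "\<dots> = (\<Sum>x\<in>V. 2 - real (d x))"
    using deg by (intro sum.cong) (auto simp: spin_def)
  finally have "\<bar>of_int k :: real\<bar> \<le> 1" using S assms(3) by simp
  then have "\<bar>k\<bar> \<le> 1" by linarith
  then have "k = -1 \<or> k = 0 \<or> k = 1" by linarith
  then show ?thesis unfolding S P by auto
qed

lemma spin_sum_square_eq_imp_le_2:
  assumes fin: "finite V" and total: "(\<Sum>x\<in>V. 2 - real (d x)) = 2"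
    and eq: "\<And>Y. Y \<subseteq> V \<Longrightarrow>
      (\<Sum>x\<in>V. (2 - real (d x)) * spin Y x)\<^sup>2 = 2 * (1 + (\<Prod>x\<in>V. spin Y x ^ d x))"
    and x: "x \<in> V"
  shows "d x \<le> 2"
proof -
  \<comment> \<open>Spin -1 on exactly the negative charges yields the sum of absolute charges.
    Equality caps it at 2, the signed total, so no charge is negative.\<close>
  define Y where "Y = {y \<in> V. 2 < d y}"
  have Y: "Y \<subseteq> V" by (auto simp: Y_def)
  have S: "(\<Sum>y\<in>V. (2 - real (d y)) * spin Y y) = (\<Sum>y\<in>V. \<bar>2 - real (d y)\<bar>)"
    by (intro sum.cong) (auto simp: Y_def spin_def)
  obtain k :: int where "(\<Prod>y\<in>V. spin Y y ^ d y) = (if even k then -1 else 1)"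
    using spin_sum_parity[OF fin Y total] .
  then have "(\<Prod>y\<in>V. spin Y y ^ d y) \<le> 1" by simp
  then have "(\<Sum>y\<in>V. \<bar>2 - real (d y)\<bar>)\<^sup>2 \<le> 2\<^sup>2"
    using eq[OF Y] unfolding S by simp
  then have "(\<Sum>y\<in>V. \<bar>2 - real (d y)\<bar>) \<le> 2"
    by (rule power2_le_imp_le) simp
  then have "(\<Sum>y\<in>V. \<bar>2 - real (d y)\<bar> - (2 - real (d y))) \<le> 0"
    using total by (simp add: sum_subtractf)
  moreover have "\<bar>2 - real (d x)\<bar> - (2 - real (d x)) \<le> (\<Sum>y\<in>V. \<bar>2 - real (d y)\<bar> - (2 - real (d y)))"
    by (rule member_le_sum[OF x _ fin]) auto
  ultimately show ?thesis by linarith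
qed

section \<open>The second moment of the charged spin sum\<close>

lemma leaf_tree_charge_energy:
  fixes \<alpha> :: real
  assumes tree: "leaf_tree V E" and \<alpha>: "\<bar>\<alpha>\<bar> \<le> 1"
  defines "Q \<equiv> \<Sum>x\<in>V. \<Sum>y\<in>V. (2 - real (deg E x)) * (2 - real (deg E y)) * \<alpha> ^ rdist E x y"
  shows "2 * (1 + \<alpha> ^ (card V - 1)) \<le> Q"
    and "(\<And>x. x \<in> V \<Longrightarrow> deg E x \<le> 2) \<Longrightarrow> Q = 2 * (1 + \<alpha> ^ (card V - 1))"
    and "Q = 2 * (1 + \<alpha> ^ (card V - 1)) \<Longrightarrow> \<bar>\<alpha>\<bar> < 1 \<Longrightarrow> x \<in> V \<Longrightarrow> deg E x \<le> 2"
proof -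
  have fin: "finite V" using tree by (rule leaf_tree_finite)
  note total = leaf_tree_sum_charge[OF tree]
  obtain w where w: "\<And>Y. Y \<in> Pow V \<Longrightarrow> 0 \<le> w Y" "\<And>Y. Y \<in> Pow V \<Longrightarrow> \<bar>\<alpha>\<bar> < 1 \<Longrightarrow> 0 < w Y"
    and corr: "\<And>x y. x \<in> V \<Longrightarrow> y \<in> V \<Longrightarrow> (\<Sum>Y\<in>Pow V. w Y * (spin Y x * spin Y y)) = \<alpha> ^ rdist E x y"
    and parity: "(\<Sum>Y\<in>Pow V. w Y * (\<Prod>x\<in>V. spin Y x ^ deg E x)) = \<alpha> ^ (card V - 1)"
    using leaf_tree_spin_weights[OF tree \<alpha>] by blast
  define S where "S Y = (\<Sum>x\<in>V. (2 - real (deg E x)) * spin Y x)" for Y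
  define P where "P Y = (\<Prod>x\<in>V. spin Y x ^ deg E x)" for Y
  obtain r where r: "r \<in> V" using leaf_tree_nonempty[OF tree] by blast
  have one: "(\<Sum>Y\<in>Pow V. w Y) = 1" using corr[OF r r] by simp
  have "Q = (\<Sum>x\<in>V. \<Sum>y\<in>V. \<Sum>Y\<in>Pow V.
      w Y * (((2 - real (deg E x)) * spin Y x) * ((2 - real (deg E y)) * spin Y y)))"
    unfolding Q_def
    by (intro sum.cong) (simp_all add: corr[symmetric] sum_distrib_left mult_ac)
  also have "\<dots> = (\<Sum>x\<in>V. \<Sum>Y\<in>Pow V. \<Sum>y\<in>V.
      w Y * (((2 - real (deg E x)) * spin Y x) * ((2 - real (deg E y)) * spin Y y)))"
    by (intro sum.cong refl sum.swap)
  also have "\<dots> = (\<Sum>Y\<in>Pow V. \<Sum>x\<in>V. \<Sum>y\<in>V.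
      w Y * (((2 - real (deg E x)) * spin Y x) * ((2 - real (deg E y)) * spin Y y)))"
    by (rule sum.swap)
  also have "\<dots> = (\<Sum>Y\<in>Pow V. w Y * (S Y)\<^sup>2)"
    unfolding S_def power2_eq_square sum_product by (simp add: sum_distrib_left)
  finally have Q: "Q = (\<Sum>Y\<in>Pow V. w Y * (S Y)\<^sup>2)" .
  have bound: "2 * (1 + \<alpha> ^ (card V - 1)) = (\<Sum>Y\<in>Pow V. w Y * (2 * (1 + P Y)))"
  proof -
    have "(\<Sum>Y\<in>Pow V. w Y * (2 * (1 + P Y))) = (\<Sum>Y\<in>Pow V. 2 * w Y + 2 * (w Y * P Y))"
      by (simp add: algebra_simps)
    then show ?thesis
      using one parity by (simp add: P_def sum.distrib sum_distrib_left[symmetric])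
  qed
  have le: "w Y * (2 * (1 + P Y)) \<le> w Y * (S Y)\<^sup>2" if "Y \<in> Pow V" for Y
    using spin_sum_square_ge[OF fin _ total, of Y] w(1)[OF that] that
    by (intro mult_left_mono) (auto simp: P_def S_def)
  show "2 * (1 + \<alpha> ^ (card V - 1)) \<le> Q"
    unfolding Q bound by (intro sum_mono le)
  show "Q = 2 * (1 + \<alpha> ^ (card V - 1))" if "\<And>x. x \<in> V \<Longrightarrow> deg E x \<le> 2"
    unfolding Q bound
  proof (intro sum.cong refl)
    fix Y assume "Y \<in> Pow V"
    then show "w Y * (S Y)\<^sup>2 = w Y * (2 * (1 + P Y))"
      using spin_sum_square_eq[OF fin _ total that, of Y] by (simp add: S_def P_def)
  qed
  show "deg E x \<le> 2" if eq: "Q = 2 * (1 + \<alpha> ^ (card V - 1))" and "\<bar>\<alpha>\<bar> < 1" "x \<in> V"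
  proof (rule spin_sum_square_eq_imp_le_2[OF fin total _ \<open>x \<in> V\<close>])
    fix Y assume "Y \<subseteq> V"
    then have Y: "Y \<in> Pow V" by simp
    \<comment> \<open>The weighted gaps are nonnegative and sum to 0, so each vanishes; its positive
      weight can then be cancelled.\<close>
    have "(\<Sum>Y\<in>Pow V. w Y * (S Y)\<^sup>2 - w Y * (2 * (1 + P Y))) = 0"
      using eq unfolding Q bound by (simp add: sum_subtractf)
    then have "w Y * (S Y)\<^sup>2 - w Y * (2 * (1 + P Y)) = 0"
      using le fin Y by (subst (asm) sum_nonneg_eq_0_iff) auto
    then have "(S Y)\<^sup>2 = 2 * (1 + P Y)"
      using w(2)[OF Y \<open>\<bar>\<alpha>\<bar> < 1\<close>] by simp
    then show "(\<Sum>x\<in>V. (2 - real (deg E x)) * spin Y x)\<^sup>2 = 2 * (1 + (\<Prod>x\<in>V. spin Y x ^ deg E x))"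
      by (simp add: S_def P_def)
  qed
qed

section \<open>Trees of maximum degree two\<close>

text \<open>\<open>f\<close> numbers the vertices along the path. Before the leaf is attached,
  \<open>u\<close> has degree at most 1, so it sits at an end and the numbering can continue from
  there.\<close>

lemma leaf_tree_path_iso:
  assumes "leaf_tree V E" "\<And>x. x \<in> V \<Longrightarrow> deg E x \<le> 2"
  shows "\<exists>f. bij_betw f V {..<card V} \<and>
    (\<forall>x\<in>V. \<forall>y\<in>V. (x, y) \<in> E \<longleftrightarrow> f y = Suc (f x) \<or> f x = Suc (f y))"
  using assms
proof (induction rule: leaf_tree.induct)
  case (single r)
  then show ?case by (intro exI[of _ "\<lambda>_. 0"]) (auto simp: bij_betw_def)
next
  case (leaf V E u v)
  define E' where "E' = insert (u, v) (insert (v, u) E)"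
  define n where "n = card V"
  note deg = deg_leaf[OF leaf.hyps E'_def]
  note u = leaf.hyps(2) and v = leaf.hyps(3)
  note E = leaf_tree_subset[OF leaf.hyps(1)]
  have fin: "finite V" using leaf.hyps(1) by (rule leaf_tree_finite)
  have n: "n > 0" using u fin by (auto simp: n_def card_gt_0_iff)
  have deg': "deg E' x \<le> 2" if "x \<in> insert v V" for x using leaf.prems that by (simp add: E'_def)
  have "deg E x \<le> 2" if "x \<in> V" for x
    using deg'[of x] deg(2) deg(3)[OF that] that by (cases "x = u") auto
  then obtain f where f: "bij_betw f V {..<n}"
    and adj: "\<And>x y. x \<in> V \<Longrightarrow> y \<in> V \<Longrightarrow> (x, y) \<in> E \<longleftrightarrow> f y = Suc (f x) \<or> f x = Suc (f y)"
    using leaf.IH by (auto simp: n_def)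
  have im: "f ` V = {..<n}" using f by (auto simp: bij_betw_def)
  \<comment> \<open>An interior position would give \<open>u\<close> two neighbours in
    \<open>V\<close>, and a third one with \<open>v\<close>.\<close>
  have "f u = 0 \<or> f u = n - 1"
  proof (rule ccontr)
    assume "\<not> ?thesis"
    moreover have "f u < n" using u im by auto
    ultimately have "f u - 1 \<in> f ` V" "Suc (f u) \<in> f ` V" "f u > 0" using im by auto
    then obtain a b where ab: "a \<in> V" "b \<in> V" "f a = f u - 1" "f b = Suc (f u)" by force
    then have "{a, b} \<subseteq> E `` {u}" "a \<noteq> b" using adj[OF u] \<open>f u > 0\<close> by auto
    then have "2 \<le> deg E u"
      using card_mono[OF leaf_tree_finite_edges[OF leaf.hyps(1)], of "{a, b}" u] by simp
    then show False using deg'[of u] deg(2) u by simp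
  qed
  then have "\<exists>g. bij_betw g V {..<n} \<and> g u = n - 1 \<and>
    (\<forall>x\<in>V. \<forall>y\<in>V. (x, y) \<in> E \<longleftrightarrow> g y = Suc (g x) \<or> g x = Suc (g y))"
  proof
    assume "f u = n - 1"
    then show ?thesis using f adj by blast
  next
    \<comment> \<open>Reversing the numbering moves \<open>u\<close> to the last position.\<close>
    assume u0: "f u = 0"
    have lt: "f x < n" if "x \<in> V" for x using im that by auto
    have "bij_betw (\<lambda>k. n - 1 - k) {..<n} {..<n}"
      by (rule bij_betwI[of _ _ _ "\<lambda>k. n - 1 - k"]) (use n in auto)
    then have "bij_betw (\<lambda>x. n - 1 - f x) V {..<n}"
      using bij_betw_trans[OF f] by (simp add: o_def)
    moreover have "(x, y) \<in> E \<longleftrightarrow> n - 1 - f y = Suc (n - 1 - f x) \<or> n - 1 - f x = Suc (n - 1 - f y)"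
      if "x \<in> V" "y \<in> V" for x y
      unfolding adj[OF that] using lt[OF that(1)] lt[OF that(2)] by arith
    ultimately show ?thesis using u0 by (intro exI[of _ "\<lambda>x. n - 1 - f x"]) simp
  qed
  then obtain g where g: "bij_betw g V {..<n}" "g u = n - 1"
    and gadj: "\<And>x y. x \<in> V \<Longrightarrow> y \<in> V \<Longrightarrow> (x, y) \<in> E \<longleftrightarrow> g y = Suc (g x) \<or> g x = Suc (g y)"
    by blast
  have glt: "g x < n" if "x \<in> V" for x using g(1) that by (auto simp: bij_betw_def)
  have gu: "g x = n - 1 \<longleftrightarrow> x = u" if "x \<in> V" for x
    using g u that by (metis bij_betw_def inj_on_eq_iff)
  \<comment> \<open>Among the old numbers only \<open>n - 1\<close> is next to \<open>n\<close>, and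
    it belongs to \<open>u\<close> alone.\<close>
  let ?h = "g(v := n)"
  have "bij_betw ?h V {..<n}"
    using g(1) v by (subst bij_betw_cong[of V _ g]) auto
  then have "bij_betw ?h (insert v V) (insert n {..<n})"
    using v by (intro bij_betw_combine[of _ V _ "{v}" "{n}", simplified]) (auto simp: bij_betw_def)
  moreover have "insert n {..<n} = {..<card (insert v V)}"
    using fin v by (auto simp: n_def)
  moreover have "(x, y) \<in> E' \<longleftrightarrow> ?h y = Suc (?h x) \<or> ?h x = Suc (?h y)"
    if xy: "x \<in> insert v V" "y \<in> insert v V" for x y
  proof -
    have uv: "u \<noteq> v" and vE: "(v, z) \<notin> E" "(z, v) \<notin> E" for z using E u v by auto
    consider "x \<in> V" "y \<in> V" | "x = v" "y = v" | "x = v" "y \<in> V" | "x \<in> V" "y = v"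
      using xy by blast
    then show ?thesis
    proof cases
      case 1
      then have "x \<noteq> v" "y \<noteq> v" using v by auto
      then show ?thesis using gadj[OF 1] by (simp add: E'_def)
    next
      case 2
      then show ?thesis using uv vE by (simp add: E'_def)
    next
      case 3
      then have "y \<noteq> v" using v by auto
      then show ?thesis using 3 uv vE gu[OF 3(2)] glt[OF 3(2)] n by (auto simp: E'_def)
    next
      case 4
      then have "x \<noteq> v" using v by auto
      then show ?thesis using 4 uv vE gu[OF 4(1)] glt[OF 4(1)] n by (auto simp: E'_def)
    qed
  qed
  ultimately show ?case unfolding E'_def[symmetric] by (metis (no_types, lifting))
qed

section \<open>Undirected trees are grown leaf by leaf\<close>

text \<open>
  A proper induced subgraph built by adding leaves can be enlarged: by connectedness some arc
  leaves it, and by acyclicity the new vertex has only one neighbour inside.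
\<close>

lemma undirected_tree_leaf_tree:
  assumes "undirected_tree T"
  shows "leaf_tree (pverts T) (parcs T)"
proof -
  define V E where "V = pverts T" and "E = parcs T"
  interpret pair_graph T using assms by (simp add: undirected_tree_def)
  have fin: "finite V" unfolding V_def by (rule pair_finite_verts)
  have sub: "E \<subseteq> V \<times> V" using in_arcsD1 in_arcsD2 by (auto simp: V_def E_def)
  have sym: "(x, y) \<in> E \<Longrightarrow> (y, x) \<in> E" for x y using arcs_symmetric by (simp add: E_def)
  have irrefl: "(x, y) \<in> E \<Longrightarrow> x \<noteq> y" for x y using no_loops' by (simp add: E_def)
  have conn: "strongly_connected T"
    using assms symmetric_connected_imp_strongly_connected[OF pair_sym_arcs]
    by (simp add: undirected_tree_def)
  \<comment> \<open>Length 2 must stay allowed: it is an edge traversed back and forth.\<close>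
  have acyclic: "length p < 3" if "pcas x p x" "set p \<subseteq> E" "x \<in> V" "distinct (tl (pawalk_verts x p))" for x p
  proof (rule ccontr)
    assume len: "\<not> length p < 3"
    then have "cycle p"
      using that unfolding cycle_def awalk_def V_def E_def by auto
    then show False using assms len by (auto simp: undirected_tree_def)
  qed
  have grow: "\<exists>v\<in>V - W. leaf_tree (insert v W) (E \<inter> insert v W \<times> insert v W)"
    if W: "leaf_tree W (E \<inter> W \<times> W)" "W \<subset> V" for W
  proof -
    obtain r t where r: "r \<in> W" and t: "t \<in> V" "t \<notin> W"
      using leaf_tree_nonempty[OF W(1)] W(2) by blast
    have "r \<rightarrow>\<^sup>*\<^bsub>with_proj T\<^esub> t"
      using conn r t W(2) by (auto simp: strongly_connected_def V_def)
    then obtain p where p: "awalk r p t" by (auto simp: reachable_awalk)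
    \<comment> \<open>The arc is the one by which the walk first leaves \<open>W\<close>.\<close>
    have "\<exists>u v. u \<in> W \<and> v \<notin> W \<and> (u, v) \<in> E"
      if "pcas r p t" "set p \<subseteq> E" "r \<in> W" for r p
      using that t(2)
    proof (induction p arbitrary: r)
      case (Cons e p)
      then show ?case by (cases e; cases "snd e \<in> W") auto
    qed auto
    then obtain u v where uv: "u \<in> W" "v \<notin> W" "(u, v) \<in> E"
      using p r unfolding awalk_def E_def by blast
    have uniq: "z = u" if z: "z \<in> W" "(z, v) \<in> E" for z
    proof (rule ccontr)
      assume "z \<noteq> u"
      obtain p where p: "pcas u p z" "set p \<subseteq> E \<inter> W \<times> W" "distinct (pawalk_verts u p)"
          "set (pawalk_verts u p) \<subseteq> W"
        using leaf_tree_path[OF W(1) uv(1) z(1)] by blast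
      have "p \<noteq> []" using p(1) \<open>z \<noteq> u\<close> by auto
      \<comment> \<open>A simple path inside \<open>W\<close> from \<open>u\<close> to a second
        neighbour \<open>z\<close> closes up through \<open>v\<close>; being nonempty, it makes the
        cycle at least 3 long.\<close>
      have "length ((v, u) # p @ [(z, v)]) < 3"
      proof (rule acyclic)
        show "pcas v ((v, u) # p @ [(z, v)]) v" using pcas_snoc[OF p(1), of v] by simp
        show "set ((v, u) # p @ [(z, v)]) \<subseteq> E" using p(2) sym[OF uv(3)] z(2) by auto
        show "v \<in> V" using sub uv(3) by auto
        show "distinct (tl (pawalk_verts v ((v, u) # p @ [(z, v)])))"
          using p(3,4) pcas_snoc[OF p(1), of v] uv(2) by auto
      qed
      then show False using \<open>p \<noteq> []\<close> by (cases p) auto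
    qed
    \<comment> \<open>With \<open>u\<close> the only neighbour inside and no loop at
      \<open>v\<close>, just the two orientations of one edge are added.\<close>
    have "E \<inter> insert v W \<times> insert v W = insert (u, v) (insert (v, u) (E \<inter> W \<times> W))"
      using uv sym[OF uv(3)] uniq uniq[OF _ sym] irrefl[of v v] by blast
    moreover have "v \<in> V" using sub uv(3) by auto
    ultimately show ?thesis using leaf_tree.leaf[OF W(1) uv(1,2)] uv(2) by (metis DiffI)
  qed
  \<comment> \<open>Repeated growth from one vertex reaches every positive size up to that of
    \<open>V\<close>.\<close>
  have "\<exists>W. W \<subseteq> V \<and> card W = Suc k \<and> leaf_tree W (E \<inter> W \<times> W)" if "Suc k \<le> card V" for k
    using that
  proof (induction k)
    case 0
    then obtain r where "r \<in> V" by fastforce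
    moreover have "E \<inter> {r} \<times> {r} = {}" using irrefl by auto
    ultimately show ?case using leaf_tree.single[of r] by (intro exI[of _ "{r}"]) auto
  next
    case (Suc k)
    then obtain W where W: "W \<subseteq> V" "card W = Suc k" "leaf_tree W (E \<inter> W \<times> W)" by auto
    then have "W \<subset> V" using Suc.prems by auto
    then obtain v where "v \<in> V - W" "leaf_tree (insert v W) (E \<inter> insert v W \<times> insert v W)"
      using grow[OF W(3)] by blast
    then show ?case
      using W finite_subset[OF W(1) fin] by (intro exI[of _ "insert v W"]) auto
  qed
  moreover have "0 < card V"
    using conn fin by (auto simp: strongly_connected_def V_def card_gt_0_iff)
  ultimately obtain W where "W \<subseteq> V" "card W = card V" "leaf_tree W (E \<inter> W \<times> W)"
    by (metis Suc_pred le_refl)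
  moreover have "W = V" using calculation fin by (simp add: card_subset_eq)
  ultimately have "leaf_tree V E" using sub by (simp add: Int_absorb2)
  then show ?thesis by (simp add: V_def E_def)
qed

section \<open>The line as a tree\<close>

lemma line_graph_tree_simps [simp]:
  "pverts (line_graph_tree n) = {..<n}"
  "(i, j) \<in> parcs (line_graph_tree n) \<longleftrightarrow> i < n \<and> j < n \<and> (j = Suc i \<or> i = Suc j)"
  by (simp_all add: line_graph_tree_def)

lemma leaf_tree_line:
  assumes "n \<ge> 1"
  shows "leaf_tree {..<n} (parcs (line_graph_tree n))"
  using assms
proof (induction n rule: dec_induct)
  case base
  have "parcs (line_graph_tree 1) = {}" "{..<1::nat} = {0}" by auto
  then show ?case using leaf_tree.single[of "0::nat"] by simp
next
  case (step n)
  have "parcs (line_graph_tree (Suc n))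
      = insert (n - 1, n) (insert (n, n - 1) (parcs (line_graph_tree n)))"
    using step.hyps by auto
  then show ?case
    using leaf_tree.leaf[OF step.IH, of "n - 1" n] step.hyps by (simp add: lessThan_Suc)
qed

lemma line_graph_tree_deg_le: "deg (parcs (line_graph_tree n)) i \<le> 2"
proof -
  \<comment> \<open>At \<open>i = 0\<close> truncation makes \<open>i - 1\<close> equal to 0, which
    still leaves a valid superset.\<close>
  have "parcs (line_graph_tree n) `` {i} \<subseteq> {i - 1, Suc i}" by auto
  then have "deg (parcs (line_graph_tree n)) i \<le> card {i - 1, Suc i}" by (intro card_mono) auto
  also have "\<dots> \<le> 2" by (simp add: card_insert_if)
  finally show ?thesis .
qed

text \<open>A walk in the line that does not turn back keeps its direction.\<close>

lemma line_graph_tree_path_length: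
  assumes "pcas x p y" "set p \<subseteq> parcs (line_graph_tree n)" "distinct (pawalk_verts x p)" "p \<noteq> []"
  shows "if snd (hd p) = Suc x then y = x + length p else x = y + length p"
  using assms
proof (induction p arbitrary: x)
  case (Cons e p)
  obtain b where e: "e = (x, b)" using Cons.prems(1) by (cases e) auto
  have xb: "b = Suc x \<or> x = Suc b" using Cons.prems(2) e by auto
  show ?case
  proof (cases p)
    case Nil
    then show ?thesis using Cons.prems(1) e xb by auto
  next
    case (Cons e' p')
    obtain c where e': "e' = (b, c)" using Cons.prems(1) Cons e by (cases e') auto
    have "b = Suc c \<or> c = Suc b" using Cons.prems(2) Cons e' by auto
    \<comment> \<open>Turning back would repeat \<open>x\<close>, so the second arc has the
      direction of the first.\<close>
    moreover have "c \<noteq> x"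
      using Cons.prems(1,3) unfolding Cons e e' by (cases p') auto
    moreover have "if c = Suc b then y = b + length p else b = y + length p"
      using Cons.IH[of b] Cons.prems(1-3) e e' Cons by auto
    ultimately show ?thesis using xb e by (auto split: if_splits)
  qed
qed simp

lemma undirected_tree_line:
  assumes "n \<ge> 1"
  shows "undirected_tree (line_graph_tree n)"
proof -
  let ?L = "line_graph_tree n"
  have "parcs ?L \<subseteq> {..<n} \<times> {..<n}" by auto
  then have "finite (parcs ?L)" by (rule finite_subset) simp
  then interpret pair_graph ?L
    by unfold_locales (auto simp: symmetric_def sym_def)
  have "(parcs ?L)\<^sup>s = parcs ?L" by (auto simp: symcl_def)
  moreover have "i \<rightarrow>\<^sup>*\<^bsub>with_proj ?L\<^esub> j" if ij: "i < n" "j < n" for i j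
  proof -
    obtain p where "pcas i p j" "set p \<subseteq> parcs ?L"
      using leaf_tree_path[OF leaf_tree_line[OF assms], of i j] ij by auto
    then have "awalk i p j" using ij by (simp add: awalk_def)
    then show ?thesis by (rule reachable_awalkI)
  qed
  ultimately have "Digraph_Component.connected ?L"
    using assms unfolding connected_conv reachable_def by (auto simp: lessThan_empty_iff bot_nat_def)
  moreover have "\<not> (cycle p \<and> 3 \<le> length p)" for p
  proof
    assume p: "cycle p \<and> 3 \<le> length p"
    then obtain i where "awalk i p i" and dist: "distinct (tl (pawalk_verts i p))"
      by (auto simp: cycle_def)
    then have i: "pcas i p i" "set p \<subseteq> parcs ?L" by (auto simp: awalk_def)
    obtain b q where q: "p = (i, b) # q"
      using p i(1) by (cases p) auto
    have ib: "b = Suc i \<or> i = Suc b" using i q by auto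
    have "q \<noteq> []" using p q by auto
    \<comment> \<open>The rest \<open>q\<close> of the cycle is a simple walk from \<open>b\<close>
      back to \<open>i\<close>, so these differ by its length, at least 2, although they are
      adjacent.\<close>
    then have "if snd (hd q) = Suc b then i = b + length q else b = i + length q"
      using line_graph_tree_path_length[of b q i n] i dist p q by auto
    then show False using ib p q by (auto split: if_splits)
  qed
  ultimately show ?thesis
    unfolding undirected_tree_def using pair_graph by blast
qed

section \<open>Isomorphism with the line and the extremal result\<close>

lemma undirected_tree_iso_line:
  assumes "undirected_tree A" "\<And>x. x \<in> pverts A \<Longrightarrow> deg (parcs A) x \<le> 2"
  shows "digraph_iso (with_proj A) (with_proj (line_graph_tree (card (pverts A))))"
proof -
  let ?L = "line_graph_tree (card (pverts A))"
  interpret pair_graph A using assms(1) by (simp add: undirected_tree_def)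
  obtain f where f: "bij_betw f (pverts A) {..<card (pverts A)}"
    and adj: "\<And>x y. x \<in> pverts A \<Longrightarrow> y \<in> pverts A \<Longrightarrow>
      (x, y) \<in> parcs A \<longleftrightarrow> f y = Suc (f x) \<or> f x = Suc (f y)"
    using leaf_tree_path_iso[OF undirected_tree_leaf_tree[OF assms(1)] assms(2)] by blast
  \<comment> \<open>Arcs are pairs, so the vertex bijection acts on them componentwise.\<close>
  let ?h = "\<lparr>iso_verts = f, iso_arcs = map_prod f f, iso_head = snd, iso_tail = fst\<rparr>"
  have inj: "inj_on f (pverts A)" and im: "f ` pverts A = {..<card (pverts A)}"
    using f by (auto simp: bij_betw_def)
  have sub: "parcs A \<subseteq> pverts A \<times> pverts A" using in_arcsD1 in_arcsD2 by auto
  have "inj_on (map_prod f f) (parcs A)"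
    using map_prod_inj_on[OF inj inj] sub by (rule inj_on_subset)
  then have "digraph_isomorphism ?h"
    unfolding digraph_isomorphism_def using inj wf_digraph by auto
  moreover have "map_prod f f ` parcs A = parcs ?L"
  proof (intro set_eqI iffI)
    fix e assume "e \<in> map_prod f f ` parcs A"
    then obtain x y where "(x, y) \<in> parcs A" "e = (f x, f y)" by auto
    then show "e \<in> parcs ?L" using sub adj[of x y] im by auto
  next
    fix e assume e: "e \<in> parcs ?L"
    obtain i j where ij: "e = (i, j)" by (cases e)
    then have "i \<in> f ` pverts A" "j \<in> f ` pverts A" using e im by auto
    then obtain x y where "x \<in> pverts A" "y \<in> pverts A" "i = f x" "j = f y" by blast
    then show "e \<in> map_prod f f ` parcs A"
      using e ij adj[of x y] by (intro image_eqI[of _ _ "(x, y)"]) auto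
  qed
  then have "with_proj ?L = app_iso ?h (with_proj A)"
    using im by (simp add: with_proj_def app_iso_def)
  ultimately show ?thesis unfolding digraph_iso_def by blast
qed

lemma hosoya_wiener_rdist:
  "hosoya_wiener A \<alpha> = (\<Sum>x\<in>pverts A. \<Sum>y\<in>pverts A. \<alpha> ^ rdist (parcs A) x y)"
  by (simp add: hosoya_wiener_def graph_dist_eq_rdist)

theorem lemma1p5:
  fixes \<alpha> :: real and n :: nat
  assumes "\<alpha> \<in> {-1..1}" and "n \<ge> 1"
  shows "undirected_tree (line_graph_tree n) \<and> card (pverts (line_graph_tree n)) = n
    \<and> (\<forall>A :: 'a pair_pre_digraph. undirected_tree A \<and> card (pverts A) = n
          \<longrightarrow> hosoya_wiener (line_graph_tree n) \<alpha> \<le> hosoya_wiener A \<alpha>)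
    \<and> (\<alpha> \<in> {-1<..<0} \<union> {0<..<1} \<longrightarrow>
        (\<forall>A :: 'a pair_pre_digraph. undirected_tree A \<and> card (pverts A) = n
            \<and> hosoya_wiener A \<alpha> = hosoya_wiener (line_graph_tree n) \<alpha>
          \<longrightarrow> digraph_iso (with_proj A) (with_proj (line_graph_tree n))))"
proof -
  let ?L = "line_graph_tree n"
  let ?M = "2 * (1 + \<alpha> ^ (n - 1))"
  \<comment> \<open>The part of the energy identity shared by all trees with \<open>n\<close>
    vertices.\<close>
  define c where "c = real n * (1 - \<alpha>\<^sup>2) - 2 * \<alpha> * (1 + \<alpha>)"
  have \<alpha>: "\<bar>\<alpha>\<bar> \<le> 1" using assms(1) by auto
  have line: "(1 - \<alpha>)\<^sup>2 * hosoya_wiener ?L \<alpha> = c + \<alpha>\<^sup>2 * ?M"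
    using leaf_tree_energy[OF leaf_tree_line[OF assms(2)], of \<alpha>]
      leaf_tree_charge_energy(2)[OF leaf_tree_line[OF assms(2)] \<alpha> line_graph_tree_deg_le]
    by (simp add: hosoya_wiener_rdist c_def)
  define Q where "Q A = (\<Sum>x\<in>pverts A. \<Sum>y\<in>pverts A. (2 - real (deg (parcs A) x)) *
    (2 - real (deg (parcs A) y)) * \<alpha> ^ rdist (parcs A) x y)" for A :: "'a pair_pre_digraph"
  have tree: "(1 - \<alpha>)\<^sup>2 * hosoya_wiener A \<alpha> = c + \<alpha>\<^sup>2 * Q A" and bound: "?M \<le> Q A"
    and eq: "Q A = ?M \<Longrightarrow> \<bar>\<alpha>\<bar> < 1 \<Longrightarrow> x \<in> pverts A \<Longrightarrow> deg (parcs A) x \<le> 2"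
    if "undirected_tree A" "card (pverts A) = n" for A :: "'a pair_pre_digraph" and x
    using leaf_tree_energy[OF undirected_tree_leaf_tree[OF that(1)], of \<alpha>]
      leaf_tree_charge_energy(1,3)[OF undirected_tree_leaf_tree[OF that(1)] \<alpha>] that(2)
    by (auto simp: hosoya_wiener_rdist c_def Q_def)
  have "hosoya_wiener ?L \<alpha> \<le> hosoya_wiener A \<alpha>"
    if A: "undirected_tree A" "card (pverts A) = n" for A :: "'a pair_pre_digraph"
  proof (cases "\<alpha> = 1")
    \<comment> \<open>Here \<open>(1 - \<alpha>)\<^sup>2\<close> is 0 and cannot be cancelled, but
      both sums just count the n^2 ordered pairs.\<close>
    case True
    then show ?thesis using A(2) by (simp add: hosoya_wiener_def)
  next
    case False
    have "(1 - \<alpha>)\<^sup>2 * hosoya_wiener ?L \<alpha> \<le> (1 - \<alpha>)\<^sup>2 * hosoya_wiener A \<alpha>"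
      unfolding line tree[OF A] using bound[OF A] by (intro add_left_mono mult_left_mono) auto
    then show ?thesis using False by simp
  qed
  moreover have "digraph_iso (with_proj A) (with_proj ?L)"
    if "\<alpha> \<in> {-1<..<0} \<union> {0<..<1}" and A: "undirected_tree A" "card (pverts A) = n"
      and "hosoya_wiener A \<alpha> = hosoya_wiener ?L \<alpha>" for A :: "'a pair_pre_digraph"
  proof -
    \<comment> \<open>Equal sums force equal charge energies only after cancelling
      \<open>\<alpha>\<^sup>2\<close>, hence the exclusion of 0.\<close>
    have "\<alpha> \<noteq> 0" "\<bar>\<alpha>\<bar> < 1" using that(1) by auto
    moreover have "\<alpha>\<^sup>2 * Q A = \<alpha>\<^sup>2 * ?M" using tree[OF A] line unfolding that(4) by linarith
    ultimately have "deg (parcs A) x \<le> 2" if "x \<in> pverts A" for x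
      using eq[OF A _ _ that] by simp
    then show ?thesis using undirected_tree_iso_line[OF A(1)] A(2) by simp
  qed
  ultimately show ?thesis using undirected_tree_line[OF assms(2)] by simp
qed

end
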